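(* Let $c\neq 0$ be a real constant, let $\Delta x_i>0$ ($i\in\mathbb{Z}$) be the cell sizes of an arbitrary one-dimensional grid, let $\Delta t^n>0$, and put $\lambda_i=|c|\Delta t^n/\Delta x_i$. Suppose $0\le\lambda_i\le 1$ for all $i$. Let $(\phi_i)_{i\in\mathbb{Z}}$ be limiter functions $\phi_i:\mathbb{R}\to\mathbb{R}$ such that $$0\le\phi_i(\theta)\le 2,\qquad 0\le\frac{\phi_i(\theta)}{\theta}\le 2,\qquad\text{for all } i \text{ and all } \theta,$$ where for $\theta=0$ the second condition is understood as $\phi_i(0)=0$. Then the reconstruct-evolve-project scheme with limited slopes for $u_t+cu_x=0$ is total variation diminishing: for all data $(u_i^n)_{i\in\mathbb{Z}}$ with $\sum_i|u_i^n-u_{i+1}^n|<\infty$, the updated values $(u_i^{n+1})_{i\in\mathbb{Z}}$ satisfy $$\sum_i|u_i^{n+1}-u_{i+1}^{n+1}|\le\sum_i|u_i^n-u_{i+1}^n|.$$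
   Context: The reconstruct-evolve-project scheme for the linear advection equation $u_t+cu_x=0$ reconstructs the cell averages $u_i^n$ as $u_i^n+\sigma_i^n(x-x_i)$ on cell $i$ (center $x_i$, length $\Delta x_i$), advects this piecewise linear function exactly over a time step $\Delta t^n$, and takes cell averages. For Courant numbers $\lambda_i\le 1$ the result is $$u_i^{n+1}=u_i^n-\lambda_i(u_i^n-u_{i'}^n)-\operatorname{sgn}(c)\,\tfrac12\lambda_i\left[(1-\lambda_i)\Delta x_i\sigma_i^n-(1-\lambda_{i'})\Delta x_{i'}\sigma_{i'}^n\right],$$ where $i'$ is the upwind index: $i'=i-1$ if $c>0$ and $i'=i+1$ if $c<0$. The limited slopes are $$\sigma_i^n=\frac{1}{\Delta x_i}\phi_i(\theta_i)(u_{i+1}^n-u_i^n),\qquad \theta_i=\frac{u_i^n-u_{i-1}^n}{u_{i+1}^n-u_i^n},$$ with $\sigma_i^n=0$ when $u_{i+1}^n=u_i^n$. *)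

theory Defs
  imports "HOL-Analysis.Analysis"
begin

text \<open>
  A grid is given by its cell interfaces: \<open>xf i\<close> stands for \<open>x\<^sub>i\<^sub>-\<^sub>1\<^sub>/\<^sub>2\<close>, so that cell \<open>i\<close>
  lies between \<open>xf i\<close> and \<open>xf (i + 1)\<close>.
\<close>

definition cell :: "(int \<Rightarrow> real) \<Rightarrow> int \<Rightarrow> real set" where
  "cell xf i = {xf i..<xf (i + 1)}"

definition cell_length :: "(int \<Rightarrow> real) \<Rightarrow> int \<Rightarrow> real" where
  "cell_length xf i = xf (i + 1) - xf i"

definition cell_center :: "(int \<Rightarrow> real) \<Rightarrow> int \<Rightarrow> real" where
  "cell_center xf i = (xf i + xf (i + 1)) / 2"

definition courant :: "(int \<Rightarrow> real) \<Rightarrow> real \<Rightarrow> real \<Rightarrow> int \<Rightarrow> real" where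
  "courant xf c dt i = \<bar>c\<bar> * dt / cell_length xf i"

definition slope_ratio :: "(int \<Rightarrow> real) \<Rightarrow> int \<Rightarrow> real" where
  "slope_ratio u i = (u i - u (i - 1)) / (u (i + 1) - u i)"

definition limited_slope ::
  "(int \<Rightarrow> real) \<Rightarrow> (int \<Rightarrow> real \<Rightarrow> real) \<Rightarrow> (int \<Rightarrow> real) \<Rightarrow> int \<Rightarrow> real" where
  "limited_slope xf \<phi> u i =
     (if u (i + 1) = u i then 0
      else 1 / cell_length xf i * \<phi> i (slope_ratio u i) * (u (i + 1) - u i))"

text \<open>
  The value of \<open>reconstruct\<close> is unspecified at points in no cell. If all Courant numbers are at
  most 1, the cell lengths are bounded below by \<open>\<bar>c\<bar> * dt > 0\<close>, and the cells cover the line.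
\<close>

definition reconstruct ::
  "(int \<Rightarrow> real) \<Rightarrow> (int \<Rightarrow> real) \<Rightarrow> (int \<Rightarrow> real) \<Rightarrow> real \<Rightarrow> real" where
  "reconstruct xf u \<sigma> x =
     (let i = (THE i. x \<in> cell xf i) in u i + \<sigma> i * (x - cell_center xf i))"

definition advect :: "real \<Rightarrow> real \<Rightarrow> (real \<Rightarrow> real) \<Rightarrow> real \<Rightarrow> real" where
  "advect c t v x = v (x - c * t)"

definition cell_average :: "(int \<Rightarrow> real) \<Rightarrow> (real \<Rightarrow> real) \<Rightarrow> int \<Rightarrow> real" where
  "cell_average xf v i = integral (cell xf i) v / cell_length xf i"

definition rep_step ::
  "(int \<Rightarrow> real) \<Rightarrow> real \<Rightarrow> real \<Rightarrow> (int \<Rightarrow> real \<Rightarrow> real) \<Rightarrow> (int \<Rightarrow> real) \<Rightarrow> int \<Rightarrow> real" where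
  "rep_step xf c dt \<phi> u =
     cell_average xf (advect c dt (reconstruct xf u (limited_slope xf \<phi> u)))"


lemma reconstruct_cell:
  assumes "\<And>i. cell_length xf i > 0" and "x \<in> cell xf i"
  shows "reconstruct xf u \<sigma> x = u i + \<sigma> i * (x - cell_center xf i)"
proof -
  have less: "xf k < xf (k + 1)" for k
    using assms(1)[of k] by (simp add: cell_length_def)
  have mono: "xf j \<le> xf k" if "j \<le> k" for j k
    using that
  proof (induction k rule: int_ge_induct)
    case (step k)
    then show ?case using less[of k] by linarith
  qed simp
  have "j = i" if "x \<in> cell xf j" for j
    using that assms(2) mono[of "i + 1" j] mono[of "j + 1" i]
    by (cases i j rule: linorder_cases) (auto simp: cell_def)
  then have "(THE i. x \<in> cell xf i) = i"
    using assms(2) by blast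
  then show ?thesis by (simp add: reconstruct_def)
qed

lemma has_integral_affine_interior:
  fixes f :: "real \<Rightarrow> real"
  assumes "a \<le> b" and "\<And>x. a < x \<Longrightarrow> x < b \<Longrightarrow> f x = p + q * (x - m)"
  shows "(f has_integral (b - a) * (p + q * ((a + b) / 2 - m))) {a..b}"
proof -
  have "((\<lambda>x. p + q * (x - m)) has_integral
      ((p * b + q * (b - m)\<^sup>2 / 2) - (p * a + q * (a - m)\<^sup>2 / 2))) {a..b}"
    by (rule fundamental_theorem_of_calculus[OF assms(1)])
      (auto intro!: derivative_eq_intros simp flip: has_real_derivative_iff_has_vector_derivative)
  moreover have "(p * b + q * (b - m)\<^sup>2 / 2) - (p * a + q * (a - m)\<^sup>2 / 2)
      = (b - a) * (p + q * ((a + b) / 2 - m))"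
    by (simp add: field_simps power2_eq_square)
  ultimately have "((\<lambda>x. p + q * (x - m)) has_integral
      (b - a) * (p + q * ((a + b) / 2 - m))) {a..b}"
    by simp
  then show ?thesis
    by (rule has_integral_spike_finite[of "{a, b}", rotated -1]) (use assms(2) in auto)
qed

text \<open>The closed form of the scheme, with \<open>i'\<close> the upwind index.\<close>

lemma rep_step_closed_form:
  fixes xf u :: "int \<Rightarrow> real" and c dt :: real and \<phi> :: "int \<Rightarrow> real \<Rightarrow> real" and i :: int
  defines "\<nu> \<equiv> courant xf c dt" and "\<Delta> \<equiv> cell_length xf" and "\<sigma> \<equiv> limited_slope xf \<phi> u"
    and "i' \<equiv> (if c > 0 then i - 1 else i + 1)"
  assumes c: "c \<noteq> 0" and dt: "dt > 0" and pos: "\<And>i. cell_length xf i > 0"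
    and cfl: "\<And>i. courant xf c dt i \<le> 1"
  shows "rep_step xf c dt \<phi> u i = u i - \<nu> i * (u i - u i')
    - sgn c * (1 / 2) * \<nu> i * ((1 - \<nu> i) * \<Delta> i * \<sigma> i - (1 - \<nu> i') * \<Delta> i' * \<sigma> i')"
proof -
  define h where "h = \<bar>c\<bar> * dt"
  define R where "R = advect c dt (reconstruct xf u \<sigma>)"
  have h: "0 < h" using c dt by (simp add: h_def)
  have len: "h \<le> \<Delta> k" for k
    using cfl[of k] pos[of k] by (simp add: courant_def \<Delta>_def h_def)
  have lam: "\<nu> k = h / \<Delta> k" for k by (simp add: \<nu>_def courant_def h_def \<Delta>_def)
  have D: "\<Delta> k = xf (k + 1) - xf k" "\<Delta> k > 0" for k
    using pos[of k] by (simp_all add: \<Delta>_def cell_length_def)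
  have R: "R x = u k + \<sigma> k * ((x - c * dt) - cell_center xf k)"
    if "xf k < x - c * dt" "x - c * dt < xf (k + 1)" for x k
    unfolding R_def advect_def
    by (rule reconstruct_cell[OF pos]) (use that in \<open>auto simp: cell_def\<close>)
  have step: "rep_step xf c dt \<phi> u i = I / \<Delta> i"
    if "(R has_integral I) {xf i..xf (i + 1)}" for I
  proof -
    have "(R has_integral I) (cell xf i)"
      using that unfolding cell_def
      by (subst has_integral_spike_set_eq[where T = "{xf i..xf (i + 1)}"])
        (auto intro: negligible_subset[of "{xf (i + 1)}"])
    then show ?thesis
      by (simp add: rep_step_def cell_average_def R_def \<sigma>_def \<Delta>_def integral_unique)
  qed
  show ?thesis
  proof (cases "c > 0")
    case True
    then have cdt: "c * dt = h" and i': "i' = i - 1" and s: "sgn c = 1"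
      by (simp_all add: h_def i'_def)
    let ?m = "xf i + h"
    have 1: "(R has_integral (?m - xf i) * (u i' + \<sigma> i' * ((xf i + ?m) / 2 - (h + cell_center xf i'))))
        {xf i..?m}"
      by (rule has_integral_affine_interior)
        (use h R[of "i'"] len[of i'] D[of i'] in \<open>auto simp: cdt i' algebra_simps\<close>)
    have 2: "(R has_integral (xf (i + 1) - ?m) * (u i + \<sigma> i * ((?m + xf (i + 1)) / 2 - (h + cell_center xf i))))
        {?m..xf (i + 1)}"
      by (rule has_integral_affine_interior)
        (use h R[of i] len[of i] D[of i] in \<open>auto simp: cdt algebra_simps\<close>)
    note 3 = step[OF has_integral_combine[OF _ _ 1 2]]
    have xi: "xf i = xf i' + \<Delta> i'" "xf (i + 1) = xf i' + \<Delta> i' + \<Delta> i" "i' + 1 = i"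
      using D(1)[of i'] D(1)[of i] by (simp_all add: i')
    have "rep_step xf c dt \<phi> u i = ((?m - xf i) * (u i' + \<sigma> i' * ((xf i + ?m) / 2 - (h + cell_center xf i')))
       + (xf (i + 1) - ?m) * (u i + \<sigma> i * ((?m + xf (i + 1)) / 2 - (h + cell_center xf i)))) / \<Delta> i"
      by (rule 3) (use h len[of i] D(1)[of i] in auto)
    also have "\<dots> = u i - \<nu> i * (u i - u i')
        - sgn c * (1 / 2) * \<nu> i * ((1 - \<nu> i) * \<Delta> i * \<sigma> i - (1 - \<nu> i') * \<Delta> i' * \<sigma> i')"
      unfolding lam s cell_center_def xi using D(2)[of i] D(2)[of i']
      by (simp add: field_simps)
    finally show ?thesis .
  next
    case False
    then have cdt: "c * dt = - h" and i': "i' = i + 1" and s: "sgn c = - 1"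
      using c by (simp_all add: h_def i'_def)
    let ?m = "xf (i + 1) - h"
    have 1: "(R has_integral (?m - xf i) * (u i + \<sigma> i * ((xf i + ?m) / 2 - (cell_center xf i - h))))
        {xf i..?m}"
      by (rule has_integral_affine_interior)
        (use h R[of i] len[of i] D[of i] in \<open>auto simp: cdt algebra_simps\<close>)
    have 2: "(R has_integral (xf (i + 1) - ?m) * (u i' + \<sigma> i' * ((?m + xf (i + 1)) / 2 - (cell_center xf i' - h))))
        {?m..xf (i + 1)}"
      by (rule has_integral_affine_interior)
        (use h R[of i'] len[of i'] D[of i'] in \<open>auto simp: cdt i' algebra_simps\<close>)
    note 3 = step[OF has_integral_combine[OF _ _ 1 2]]
    have xi: "xf (i + 1) = xf i + \<Delta> i" "xf i' = xf i + \<Delta> i" "xf (i' + 1) = xf i + \<Delta> i + \<Delta> i'"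
      using D(1)[of i'] D(1)[of i] by (simp_all add: i')
    have "rep_step xf c dt \<phi> u i = ((?m - xf i) * (u i + \<sigma> i * ((xf i + ?m) / 2 - (cell_center xf i - h)))
       + (xf (i + 1) - ?m) * (u i' + \<sigma> i' * ((?m + xf (i + 1)) / 2 - (cell_center xf i' - h)))) / \<Delta> i"
      by (rule 3) (use h len[of i] D(1)[of i] in auto)
    also have "\<dots> = u i - \<nu> i * (u i - u i')
        - sgn c * (1 / 2) * \<nu> i * ((1 - \<nu> i) * \<Delta> i * \<sigma> i - (1 - \<nu> i') * \<Delta> i' * \<sigma> i')"
      unfolding lam s cell_center_def xi using D(2)[of i] D(2)[of i']
      by (simp add: field_simps)
    finally show ?thesis .
  qed
qed

end

theory Submission
  imports Defs
begin

text \<open>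
  The proof is Harten's argument. The two bounds on the limiter say that the increment
  \<open>\<Delta>\<^sub>i \<sigma>\<^sub>i\<close> of the reconstruction across a cell is a multiple, with factor in \<open>[0, 2]\<close>, of the
  jump of the data on either side of the cell (\<open>cell_increment_bounds\<close>). In the closed form of
  the scheme, both increments entering the update of cell \<open>i\<close> can therefore be written as
  multiples of the same jump, the one between \<open>i\<close> and its upwind neighbour \<open>i'\<close>. This makes the
  new value a convex combination of \<open>u\<^sub>i\<close> and \<open>u\<^sub>i'\<close> (\<open>rep_step_convex_combination\<close>).

  Consequently each new jump is at most the part of the old jump that stays in place plus the
  part that arrives from the upwind side, where every old jump is split with weights \<open>1 - A\<close>
  and \<open>A\<close>. Summation over all cells only redistributes the old jumps, by a shift of the index,
  so that the total does not grow (\<open>infsum_split_shift_le\<close>).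
\<close>

text \<open>
  The first multiple comes from the bound on \<open>\<phi>\<close>, the second from the bound on \<open>\<phi>(\<theta>)/\<theta>\<close>, since
  \<open>\<theta>\<close> is the quotient of the two jumps. At \<open>\<theta> = 0\<close> the backward jump vanishes, and \<open>\<phi>(0) = 0\<close>
  makes the increment vanish with it.
\<close>

lemma cell_increment_bounds:
  fixes xf u :: "int \<Rightarrow> real" and \<phi> :: "int \<Rightarrow> real \<Rightarrow> real"
  assumes pos: "cell_length xf i > 0"
    and bound: "\<And>\<theta>. 0 \<le> \<phi> i \<theta> \<and> \<phi> i \<theta> \<le> 2"
    and quot: "\<And>\<theta>. \<theta> \<noteq> 0 \<Longrightarrow> 0 \<le> \<phi> i \<theta> / \<theta> \<and> \<phi> i \<theta> / \<theta> \<le> 2"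
    and zero: "\<phi> i 0 = 0"
  obtains a b where "0 \<le> a" "a \<le> 2" "0 \<le> b" "b \<le> 2"
    and "cell_length xf i * limited_slope xf \<phi> u i = a * (u (i + 1) - u i)"
    and "cell_length xf i * limited_slope xf \<phi> u i = b * (u i - u (i - 1))"
proof (cases "u (i + 1) = u i")
  case True
  then show ?thesis
    using that[of 0 0] by (simp add: limited_slope_def)
next
  case False
  let ?\<theta> = "slope_ratio u i"
  have inc: "cell_length xf i * limited_slope xf \<phi> u i = \<phi> i ?\<theta> * (u (i + 1) - u i)"
    using False pos by (simp add: limited_slope_def)
  show ?thesis
  proof (cases "?\<theta> = 0")
    case True
    then show ?thesis
      using that[of 0 0] inc zero by simp
  next
    case nz: False
    have "u i - u (i - 1) = ?\<theta> * (u (i + 1) - u i)"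
      using False by (simp add: slope_ratio_def)
    then have "\<phi> i ?\<theta> * (u (i + 1) - u i) = \<phi> i ?\<theta> / ?\<theta> * (u i - u (i - 1))"
      using nz by simp
    then show ?thesis
      using that[of "\<phi> i ?\<theta>" "\<phi> i ?\<theta> / ?\<theta>"] inc bound quot[OF nz] by simp
  qed
qed

text \<open>
  The weight is \<open>\<nu> (1 + (1 - \<nu>) p / 2 - (1 - \<nu>') q / 2)\<close> with \<open>p\<close> and \<open>q\<close> the factors of the
  increments in cells \<open>i\<close> and \<open>i'\<close>. The limiter bound 2 is exactly what is needed: \<open>q \<le> 2\<close>
  keeps the bracket nonnegative, and \<open>p \<le> 2\<close> bounds the weight by
  \<open>\<nu> (2 - \<nu>) = 1 - (1 - \<nu>)\<^sup>2 \<le> 1\<close>.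
\<close>

lemma limited_weight_bounds:
  fixes \<nu> \<nu>' p q :: real
  assumes "0 \<le> \<nu>" "\<nu> \<le> 1" "0 \<le> \<nu>'" "\<nu>' \<le> 1" "0 \<le> p" "p \<le> 2" "0 \<le> q" "q \<le> 2"
  shows "0 \<le> \<nu> * (1 + (1 - \<nu>) * p / 2 - (1 - \<nu>') * q / 2)"
    and "\<nu> * (1 + (1 - \<nu>) * p / 2 - (1 - \<nu>') * q / 2) \<le> 1"
proof -
  let ?K = "1 + (1 - \<nu>) * p / 2 - (1 - \<nu>') * q / 2"
  have p: "0 \<le> (1 - \<nu>) * p" "(1 - \<nu>) * p \<le> (1 - \<nu>) * 2"
    by (intro mult_nonneg_nonneg mult_left_mono; use assms in simp)+
  have q: "0 \<le> (1 - \<nu>') * q" "(1 - \<nu>') * q \<le> (1 - \<nu>') * 2"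
    by (intro mult_nonneg_nonneg mult_left_mono; use assms in simp)+
  show "0 \<le> \<nu> * ?K"
    using p(1) q(2) assms(1,3) by (intro mult_nonneg_nonneg) auto
  have "\<nu> * ?K \<le> \<nu> * (2 - \<nu>)"
    using p(2) q(1) assms(1) by (intro mult_left_mono) auto
  also have "\<dots> = 1 - (1 - \<nu>)\<^sup>2"
    by (simp add: power2_eq_square algebra_simps)
  also have "\<dots> \<le> 1"
    by simp
  finally show "\<nu> * ?K \<le> 1" .
qed

text \<open>
  The jump between \<open>i\<close> and \<open>i'\<close> is the backward jump of the one cell and the forward jump of
  the other. Hence the bounds on \<open>\<phi>\<close> and on \<open>\<phi>(\<theta>)/\<theta>\<close> are used once each, and reversing the
  sign of \<open>c\<close> exchanges their roles.
\<close>

lemma rep_step_convex_combination: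
  fixes xf u :: "int \<Rightarrow> real" and c dt :: real and \<phi> :: "int \<Rightarrow> real \<Rightarrow> real" and i :: int
  defines "i' \<equiv> (if c > 0 then i - 1 else i + 1)"
  assumes c: "c \<noteq> 0" and pos: "\<And>i. cell_length xf i > 0" and dt: "dt > 0"
    and cfl: "\<And>i. 0 \<le> courant xf c dt i \<and> courant xf c dt i \<le> 1"
    and bound: "\<And>i \<theta>. 0 \<le> \<phi> i \<theta> \<and> \<phi> i \<theta> \<le> 2"
    and quot: "\<And>i \<theta>. \<theta> \<noteq> 0 \<Longrightarrow> 0 \<le> \<phi> i \<theta> / \<theta> \<and> \<phi> i \<theta> / \<theta> \<le> 2"
    and zero: "\<And>i. \<phi> i 0 = 0"
  shows "\<exists>C. 0 \<le> C \<and> C \<le> 1 \<and> rep_step xf c dt \<phi> u i = u i - C * (u i - u i')"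
proof -
  let ?\<nu> = "courant xf c dt"
  let ?s = "\<lambda>j. cell_length xf j * limited_slope xf \<phi> u j"
  obtain a b where ab: "0 \<le> a" "a \<le> 2" "0 \<le> b" "b \<le> 2"
      "?s i = a * (u (i + 1) - u i)" "?s i = b * (u i - u (i - 1))"
    by (rule cell_increment_bounds[OF pos bound quot zero])
  obtain a' b' where ab': "0 \<le> a'" "a' \<le> 2" "0 \<le> b'" "b' \<le> 2"
      "?s i' = a' * (u (i' + 1) - u i')" "?s i' = b' * (u i' - u (i' - 1))"
    by (rule cell_increment_bounds[OF pos bound quot zero])
  obtain p q where pq: "0 \<le> p" "p \<le> 2" "0 \<le> q" "q \<le> 2"
    and p: "sgn c * ?s i = p * (u i - u i')" and q: "sgn c * ?s i' = q * (u i - u i')"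
  proof (cases "c > 0")
    case True
    then have "sgn c * ?s i = b * (u i - u i')" "sgn c * ?s i' = a' * (u i - u i')"
      using ab(6) ab'(5) by (simp_all add: i'_def)
    then show ?thesis
      using that ab ab' by blast
  next
    case False
    then have "sgn c * ?s i = a * (u i - u i')" "sgn c * ?s i' = b' * (u i - u i')"
      using ab(5) ab'(6) c by (simp_all add: i'_def algebra_simps)
    then show ?thesis
      using that ab ab' by blast
  qed
  let ?C = "?\<nu> i * (1 + (1 - ?\<nu> i) * p / 2 - (1 - ?\<nu> i') * q / 2)"
  have "rep_step xf c dt \<phi> u i = u i - ?\<nu> i * (u i - u i')
      - ?\<nu> i / 2 * ((1 - ?\<nu> i) * (sgn c * ?s i) - (1 - ?\<nu> i') * (sgn c * ?s i'))"
    using rep_step_closed_form[OF c dt pos, of \<phi> u i] cfl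
    by (simp add: i'_def[symmetric] algebra_simps)
  also have "\<dots> = u i - ?C * (u i - u i')"
    unfolding p q by (simp add: field_simps)
  finally have "rep_step xf c dt \<phi> u i = u i - ?C * (u i - u i')" .
  then show ?thesis
    using limited_weight_bounds[of "?\<nu> i" "?\<nu> i'" p q] cfl[of i] cfl[of i'] pq by blast
qed

text \<open>
  The moved parts \<open>A w\<close> are themselves summable, and their sum does not change under a shift;
  what leaves one index arrives at another.
\<close>

lemma infsum_split_shift_le:
  fixes w r A :: "int \<Rightarrow> real" and k :: int
  assumes w: "w summable_on UNIV" "\<And>i. 0 \<le> w i"
    and A: "\<And>i. 0 \<le> A i" "\<And>i. A i \<le> 1"
    and r: "\<And>i. 0 \<le> r i" "\<And>i. r i \<le> (1 - A i) * w i + A (i + k) * w (i + k)"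
  shows "r summable_on UNIV \<and> infsum r UNIV \<le> infsum w UNIV"
proof -
  let ?g = "\<lambda>i. A i * w i" and ?h = "\<lambda>i. (1 - A i) * w i"
  have g: "?g summable_on UNIV"
    by (rule summable_on_comparison_test[OF w(1)])
      (use w(2) A in \<open>auto intro: mult_left_le_one_le\<close>)
  have h: "?h summable_on UNIV"
    by (rule summable_on_comparison_test[OF w(1)])
      (use w(2) A in \<open>auto intro: mult_left_le_one_le\<close>)
  have bij: "bij_betw (\<lambda>i. i + k) UNIV UNIV"
    by (rule bij_betw_byWitness[where f' = "\<lambda>i. i - k"]) auto
  have g': "(\<lambda>i. ?g (i + k)) summable_on UNIV"
    using g by (subst summable_on_reindex_bij_betw[OF bij])
  have s: "(\<lambda>i. ?h i + ?g (i + k)) summable_on UNIV"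
    by (rule summable_on_add[OF h g'])
  have rs: "r summable_on UNIV"
    by (rule summable_on_comparison_test[OF s]) (use r in auto)
  have "infsum r UNIV \<le> (\<Sum>\<^sub>\<infinity>i. ?h i + ?g (i + k))"
    by (rule infsum_mono[OF rs s]) (use r(2) in auto)
  also have "\<dots> = infsum ?h UNIV + (\<Sum>\<^sub>\<infinity>i. ?g (i + k))"
    by (rule infsum_add[OF h g'])
  also have "(\<Sum>\<^sub>\<infinity>i. ?g (i + k)) = infsum ?g UNIV"
    by (rule infsum_reindex_bij_betw[OF bij])
  also have "infsum ?h UNIV + infsum ?g UNIV = (\<Sum>\<^sub>\<infinity>i. ?h i + ?g i)"
    by (rule infsum_add[OF h g, symmetric])
  also have "\<dots> = infsum w UNIV"
    by (simp add: algebra_simps)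
  finally show ?thesis
    using rs by blast
qed

text \<open>
  For sequences, the weight with which the jump between \<open>i\<close> and \<open>i + 1\<close> moves downwind is that
  of the cell on its downwind side: cell \<open>i + 1\<close> if the upwind neighbours lie to the left, and
  cell \<open>i\<close> if they lie to the right.
\<close>

lemma total_variation_convex_combination:
  fixes u v C :: "int \<Rightarrow> real" and k :: int
  assumes k: "k = - 1 \<or> k = 1"
    and C: "\<And>i. 0 \<le> C i" "\<And>i. C i \<le> 1"
    and v: "\<And>i. v i = u i - C i * (u i - u (i + k))"
    and u: "(\<lambda>i. \<bar>u i - u (i + 1)\<bar>) summable_on UNIV"
  shows "(\<lambda>i. \<bar>v i - v (i + 1)\<bar>) summable_on UNIV
    \<and> (\<Sum>\<^sub>\<infinity>i. \<bar>v i - v (i + 1)\<bar>) \<le> (\<Sum>\<^sub>\<infinity>i. \<bar>u i - u (i + 1)\<bar>)"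
proof -
  define A where "A i = (if k = 1 then C i else C (i + 1))" for i
  let ?w = "\<lambda>i. u i - u (i + 1)"
  have A: "0 \<le> A i" "A i \<le> 1" for i
    using C by (auto simp: A_def)
  have "\<bar>v i - v (i + 1)\<bar> \<le> (1 - A i) * \<bar>?w i\<bar> + A (i + k) * \<bar>?w (i + k)\<bar>" for i
  proof -
    have "v i - v (i + 1) = (1 - A i) * ?w i + A (i + k) * ?w (i + k)"
      using k by (auto simp: v A_def algebra_simps)
    also have "\<bar>\<dots>\<bar> \<le> \<bar>(1 - A i) * ?w i\<bar> + \<bar>A (i + k) * ?w (i + k)\<bar>"
      by (rule abs_triangle_ineq)
    also have "\<dots> = (1 - A i) * \<bar>?w i\<bar> + A (i + k) * \<bar>?w (i + k)\<bar>"
      using A by (simp add: abs_mult)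
    finally show ?thesis .
  qed
  then show ?thesis
    using infsum_split_shift_le[where w = "\<lambda>i. \<bar>?w i\<bar>" and A = A and r = "\<lambda>i. \<bar>v i - v (i + 1)\<bar>" and k = k] u A by simp
qed

theorem mainTheorem1:
  fixes c dt :: real
    and xf :: "int \<Rightarrow> real"
    and \<phi> :: "int \<Rightarrow> real \<Rightarrow> real"
    and u :: "int \<Rightarrow> real"
  assumes "c \<noteq> 0"
    and "\<And>i. cell_length xf i > 0"
    and "dt > 0"
    and "\<And>i. 0 \<le> courant xf c dt i \<and> courant xf c dt i \<le> 1"
    and "\<And>i \<theta>. 0 \<le> \<phi> i \<theta> \<and> \<phi> i \<theta> \<le> 2"
    and "\<And>i \<theta>. \<theta> \<noteq> 0 \<Longrightarrow> 0 \<le> \<phi> i \<theta> / \<theta> \<and> \<phi> i \<theta> / \<theta> \<le> 2"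
    and "\<And>i. \<phi> i 0 = 0"
    and "(\<lambda>i. \<bar>u i - u (i + 1)\<bar>) summable_on UNIV"
  shows "(\<lambda>i. \<bar>rep_step xf c dt \<phi> u i - rep_step xf c dt \<phi> u (i + 1)\<bar>) summable_on UNIV
    \<and> (\<Sum>\<^sub>\<infinity>i. \<bar>rep_step xf c dt \<phi> u i - rep_step xf c dt \<phi> u (i + 1)\<bar>)
        \<le> (\<Sum>\<^sub>\<infinity>i. \<bar>u i - u (i + 1)\<bar>)"
proof -
  define k :: int where "k = (if c > 0 then - 1 else 1)"
  have "\<exists>C. 0 \<le> C \<and> C \<le> 1 \<and> rep_step xf c dt \<phi> u i = u i - C * (u i - u (i + k))" for i
    using rep_step_convex_combination[where u = u and i = i and \<phi> = \<phi>, OF assms(1-7)] by (simp add: k_def split: if_splits)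
  then obtain C where "\<And>i. 0 \<le> C i" "\<And>i. C i \<le> 1"
    "\<And>i. rep_step xf c dt \<phi> u i = u i - C i * (u i - u (i + k))"
    by metis
  then show ?thesis
    using total_variation_convex_combination[where k = k and C = C and v = "rep_step xf c dt \<phi> u" and u = u] assms(8)
    by (simp add: k_def)
qed

end
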